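(* Let $\Theta\subseteq\mathbb{R}$, let $\{p(\cdot|\theta),\ \theta\in\Theta\}$ be a family of probability density functions of $\boldsymbol{X}=(X_1,\ldots,X_n)$, and let $\rho(\varepsilon)=|\varepsilon|^t$ where $t\ge1$ is real (not necessarily an integer). Then $$R_n(\Theta)\ \ge\ \sup_{\theta_0,\theta_1,q,r}\ |\theta_1-\theta_0|^t\,\big[(1-r)^{t-1}q+r^{t-1}(1-q)\big]\cdot P_{\mathrm{e}}\left(\frac{(1-r)^{t-1}q}{(1-r)^{t-1}q+r^{t-1}(1-q)},\theta_0,\theta_1\right),$$ where the supremum is over all $\theta_0,\theta_1\in\Theta$ and $q,r\in(0,1)$.
   Context: The alphabet $\mathcal{X}\subseteq\mathbb{R}$ is the set of values of each $X_i$, and each $p(\cdot|\theta)$ is regarded as a probability density on $\mathbb{R}^n$ vanishing outside $\mathcal{X}^n$ (in the discrete case densities are probability mass functions and integrals are sums). $\mathbf{E}_\theta$ denotes expectation when $\boldsymbol{X}\sim p(\cdot|\theta)$. An estimator is a (measurable) function $g_n:\mathcal{X}^n\to\Theta$. The minimax risk is $$R_n(\Theta)=\inf_{g_n}\sup_{\theta\in\Theta}\mathbf{E}_\theta\{\rho(g_n[\boldsymbol{X}]-\theta)\},$$ the infimum being over all estimators. For $q\in[0,1]$ and $\theta_0,\theta_1\in\Theta$, $$P_{\mathrm{e}}(q,\theta_0,\theta_1)=\int_{\mathbb{R}^n}\min\{q\,p(\boldsymbol{x}|\theta_0),(1-q)\,p(\boldsymbol{x}|\theta_1)\}\,d\boldsymbol{x}.$$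 *)

theory Defs
  imports "HOL-Analysis.Analysis"
begin

definition vectors_over :: "real set \<Rightarrow> (real ^ 'n) set" where
  "vectors_over X = {x. \<forall>i. x $ i \<in> X}"

text \<open>
  \<open>M\<close> is the measure with respect to which densities are taken: Lebesgue measure for continuous
  observations, and counting measure for discrete ones, where densities are probability mass
  functions and integrals are sums.
\<close>

definition reference_measure :: "real set \<Rightarrow> (real ^ 'n) measure \<Rightarrow> bool" where
  "reference_measure X M \<longleftrightarrow>
     M = lborel \<or> (countable X \<and> M = count_space (vectors_over X))"

definition prob_density_on :: "real set \<Rightarrow> (real ^ 'n) measure \<Rightarrow> (real ^ 'n \<Rightarrow> real) \<Rightarrow> bool" where
  "prob_density_on X M f \<longleftrightarrow>
     f \<in> borel_measurable M \<and> (\<forall>x. 0 \<le> f x) \<and> (\<forall>x. x \<notin> vectors_over X \<longrightarrow> f x = 0) \<and>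
     (\<integral>\<^sup>+ x. ennreal (f x) \<partial>M) = 1"

definition estimators :: "real set \<Rightarrow> (real ^ 'n) measure \<Rightarrow> real set \<Rightarrow> (real ^ 'n \<Rightarrow> real) set" where
  "estimators X M \<Theta> =
     measurable (restrict_space M (vectors_over X)) (restrict_space borel \<Theta>)"

text \<open>
  Expectations and the minimax risk take values in the extended nonnegative reals, since the risk
  of an estimator may be infinite. The values of an estimator outside \<open>vectors_over X\<close> are
  irrelevant, because the densities vanish there.
\<close>

definition expected_loss ::
  "(real ^ 'n) measure \<Rightarrow> (real \<Rightarrow> real ^ 'n \<Rightarrow> real) \<Rightarrow> (real \<Rightarrow> real) \<Rightarrow> (real ^ 'n \<Rightarrow> real) \<Rightarrow> real \<Rightarrow> ennreal" where
  "expected_loss M p \<rho> g \<theta> = (\<integral>\<^sup>+ x. ennreal (p \<theta> x) * ennreal (\<rho> (g x - \<theta>)) \<partial>M)"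

definition minimax_risk ::
  "real set \<Rightarrow> (real ^ 'n) measure \<Rightarrow> (real \<Rightarrow> real ^ 'n \<Rightarrow> real) \<Rightarrow> (real \<Rightarrow> real) \<Rightarrow> real set \<Rightarrow> ennreal" where
  "minimax_risk X M p \<rho> \<Theta> =
     (INF g \<in> estimators X M \<Theta>. SUP \<theta> \<in> \<Theta>. expected_loss M p \<rho> g \<theta>)"

definition error_prob ::
  "(real ^ 'n) measure \<Rightarrow> (real \<Rightarrow> real ^ 'n \<Rightarrow> real) \<Rightarrow> real \<Rightarrow> real \<Rightarrow> real \<Rightarrow> real" where
  "error_prob M p q \<theta>0 \<theta>1 = (LINT x|M. min (q * p \<theta>0 x) ((1 - q) * p \<theta>1 x))"

end

(* For q' = (1-r)^(t-1) q / c with c = (1-r)^(t-1) q + r^(t-1) (1-q), the factor c turns the integrand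
   of the error probability into m = min {(1-r)^(t-1) q p0, r^(t-1) (1-q) p1}. Convexity of u^t with
   weights 1-r and r gives (1-r)^(1-t) a^t + r^(1-t) b^t \<ge> (a+b)^t. With a = |g(x) - \<theta>0|,
   b = |g(x) - \<theta>1| and a + b \<ge> |\<theta>1 - \<theta>0| this bounds the integrand of the q-weighted Bayes risk
   from below by |\<theta>1 - \<theta>0|^t m, and the Bayes risk is at most the maximal risk. *)
theory Submission
  imports Defs
begin

lemma powr_add_le_weighted:
  fixes a b r t :: real
  assumes "a \<ge> 0" "b \<ge> 0" "0 < r" "r < 1" "t \<ge> 1"
  shows "(a + b) powr t \<le> a powr t / (1 - r) powr (t - 1) + b powr t / r powr (t - 1)"
proof -
  have r: "0 < s powr (t - 1)" "s powr (t - 1) \<le> 1" if "0 < s" "s < 1" for s :: real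
    using that assms(5) by (simp_all add: powr_le1)
  have scale: "s * (c / s) powr t = c powr t / s powr (t - 1)" if "0 < s" "0 \<le> c" for s c :: real
    using that by (simp add: powr_divide powr_diff)
  have enlarge: "c powr t \<le> c powr t / s powr (t - 1)" if "0 < s" "s < 1" for s c :: real
    using r[OF that] by (simp add: pos_le_divide_eq mult_left_le)
  \<comment> \<open>If a or b vanishes, dividing the other power by \<open>s powr (t - 1)\<close>,
    which is at most 1, only enlarges it. Convexity is thus invoked at positive points only.\<close>
  consider "a = 0" | "b = 0" | "a > 0" "b > 0"
    using assms by linarith
  then show ?thesis
  proof cases
    case 1
    then show ?thesis using enlarge[of r b] assms by simp
  next
    case 2
    then show ?thesis using enlarge[of "1 - r" a] assms by simp
  next
    case 3
    \<comment> \<open>The points a / (1 - r) and b / r are chosen so that their average with weights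
      1 - r and r is a + b. By \<open>scale\<close>, the weighted powers on the right are the
      quotients of the claim.\<close>
    have "((1 - r) *\<^sub>R (a / (1 - r)) + r *\<^sub>R (b / r)) powr t
        \<le> (1 - r) * (a / (1 - r)) powr t + r * (b / r) powr t"
      using 3 assms by (intro convex_onD[OF powr_convex]) auto
    then show ?thesis
      using assms scale[of "1 - r" a] scale[of r b] by simp
  qed
qed

text \<open>Pointwise form of the bound: A and B will be the prior-weighted densities at an
  observation, and y the estimate made from it. The triangle inequality and the convexity bound are
  multiplied by the minimum; dividing the minimum by either weight leaves at most A or B
  respectively.\<close>

lemma weighted_powr_loss_ge_min:
  fixes A B r t :: real
  assumes "A \<ge> 0" "B \<ge> 0" "0 < r" "r < 1" "t \<ge> 1"
  shows "\<bar>v - u\<bar> powr t * min ((1 - r) powr (t - 1) * A) (r powr (t - 1) * B)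
    \<le> A * \<bar>y - u\<bar> powr t + B * \<bar>y - v\<bar> powr t"
    (is "_ * ?m \<le> _")
proof -
  have pos: "0 < (1 - r) powr (t - 1)" "0 < r powr (t - 1)"
    using assms by simp_all
  have m: "0 \<le> ?m" using assms pos by simp
  have mA: "?m / (1 - r) powr (t - 1) \<le> A" and mB: "?m / r powr (t - 1) \<le> B"
    using pos by (simp_all add: pos_divide_le_eq mult.commute)
  have "\<bar>v - u\<bar> powr t \<le> (\<bar>y - u\<bar> + \<bar>y - v\<bar>) powr t"
    using assms by (intro powr_mono2) auto
  also have "\<dots> \<le> \<bar>y - u\<bar> powr t / (1 - r) powr (t - 1) + \<bar>y - v\<bar> powr t / r powr (t - 1)"
    using assms by (intro powr_add_le_weighted) auto
  finally have "\<bar>v - u\<bar> powr t * ?m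
      \<le> (\<bar>y - u\<bar> powr t / (1 - r) powr (t - 1) + \<bar>y - v\<bar> powr t / r powr (t - 1)) * ?m"
    using m by (rule mult_right_mono)
  also have "\<dots> = ?m / (1 - r) powr (t - 1) * \<bar>y - u\<bar> powr t + ?m / r powr (t - 1) * \<bar>y - v\<bar> powr t"
    by (simp add: algebra_simps)
  also have "\<dots> \<le> A * \<bar>y - u\<bar> powr t + B * \<bar>y - v\<bar> powr t"
    using mA mB by (intro add_mono mult_right_mono) auto
  finally show ?thesis .
qed

text \<open>
  The set \<open>V\<close> need not be measurable, so the product is measurable only because the support of
  \<open>f\<close> is a measurable subset of \<open>V\<close>.
\<close>

lemma borel_measurable_mult_compose_restrict:
  fixes f :: "'a \<Rightarrow> real" and g :: "'a \<Rightarrow> real" and h :: "real \<Rightarrow> real"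
  assumes f [measurable]: "f \<in> borel_measurable M"
    and supp: "\<And>x. x \<notin> V \<Longrightarrow> f x = 0"
    and g: "g \<in> restrict_space M V \<rightarrow>\<^sub>M restrict_space borel \<Theta>"
    and h [measurable]: "h \<in> borel_measurable borel"
  shows "(\<lambda>x. f x * h (g x)) \<in> borel_measurable M"
proof -
  define S where "S = {x \<in> space M. f x \<noteq> 0}"
  have S: "S \<in> sets M" unfolding S_def by measurable
  have "g \<in> restrict_space M V \<rightarrow>\<^sub>M borel"
    using g by (simp add: measurable_restrict_space2_iff)
  moreover have "S \<subseteq> V"
    using supp by (auto simp: S_def)
  ultimately have "g \<in> restrict_space M S \<rightarrow>\<^sub>M borel"
    by (rule measurable_restrict_mono)
  \<comment> \<open>Off S the estimator is replaced by the default 0, which makes it measurable on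
    all of M. The product is unchanged, since f vanishes there.\<close>
  then have [measurable]: "(\<lambda>x. if x \<in> S then g x else 0) \<in> M \<rightarrow>\<^sub>M borel"
    using S by (subst (asm) measurable_restrict_space_iff[where c = 0]) auto
  have "(\<lambda>x. f x * h (if x \<in> S then g x else 0)) \<in> borel_measurable M"
    by measurable
  then show ?thesis
    by (rule measurable_cong[THEN iffD1, rotated]) (auto simp: S_def)
qed

text \<open>Bounds the Bayes risk of one estimator under the prior with mass q at \<theta>0 and 1 -
  q at \<theta>1, by integrating the pointwise bound at y = g x.\<close>

lemma Bayes_risk_ge_error_prob:
  fixes p :: "real \<Rightarrow> real ^ 'n \<Rightarrow> real"
  assumes p0: "prob_density_on X M (p \<theta>0)" and p1: "prob_density_on X M (p \<theta>1)"
    and g: "g \<in> estimators X M \<Theta>"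
    and q: "0 < q" "q < 1" and r: "0 < r" "r < 1" and t: "t \<ge> 1"
  defines "\<alpha> \<equiv> (1 - r) powr (t - 1) * q" and "\<beta> \<equiv> r powr (t - 1) * (1 - q)"
  shows "ennreal (\<bar>\<theta>1 - \<theta>0\<bar> powr t * (\<alpha> + \<beta>) * error_prob M p (\<alpha> / (\<alpha> + \<beta>)) \<theta>0 \<theta>1)
    \<le> ennreal q * expected_loss M p (\<lambda>\<epsilon>. \<bar>\<epsilon>\<bar> powr t) g \<theta>0
      + ennreal (1 - q) * expected_loss M p (\<lambda>\<epsilon>. \<bar>\<epsilon>\<bar> powr t) g \<theta>1"
proof -
  have f0 [measurable]: "p \<theta>0 \<in> borel_measurable M" and n0: "\<And>x. 0 \<le> p \<theta>0 x"
    and f1 [measurable]: "p \<theta>1 \<in> borel_measurable M" and n1: "\<And>x. 0 \<le> p \<theta>1 x"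
    using p0 p1 by (auto simp: prob_density_on_def)
  \<comment> \<open>This measurability lets the integral of the weighted sum of losses be split
    below.\<close>
  have meas: "(\<lambda>x. p \<theta> x * \<bar>g x - \<theta>\<bar> powr t) \<in> borel_measurable M"
    if "prob_density_on X M (p \<theta>)" for \<theta>
    using that g
    by (intro borel_measurable_mult_compose_restrict[where V = "vectors_over X"
          and h = "\<lambda>y. \<bar>y - \<theta>\<bar> powr t"])
      (auto simp: prob_density_on_def estimators_def)
  note [measurable] = meas[OF p0] meas[OF p1]
  define F where "F x = \<bar>\<theta>1 - \<theta>0\<bar> powr t * min (\<alpha> * p \<theta>0 x) (\<beta> * p \<theta>1 x)" for x
  have ab: "\<alpha> > 0" "\<beta> > 0"
    using q r by (simp_all add: \<alpha>_def \<beta>_def)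
  have F0: "0 \<le> F x" for x
    using ab n0 n1 by (simp add: F_def)
  have "(\<alpha> + \<beta>) * min (\<alpha> / (\<alpha> + \<beta>) * p \<theta>0 x) ((1 - \<alpha> / (\<alpha> + \<beta>)) * p \<theta>1 x)
      = min (\<alpha> * p \<theta>0 x) (\<beta> * p \<theta>1 x)" for x
  proof -
    have "(\<alpha> + \<beta>) * (\<alpha> / (\<alpha> + \<beta>)) = \<alpha>" "(\<alpha> + \<beta>) * (1 - \<alpha> / (\<alpha> + \<beta>)) = \<beta>"
      using ab by (simp_all add: field_simps)
    then show ?thesis
      using ab by (simp add: min_mult_distrib_left flip: mult.assoc)
  qed
  then have "\<bar>\<theta>1 - \<theta>0\<bar> powr t * (\<alpha> + \<beta>) * error_prob M p (\<alpha> / (\<alpha> + \<beta>)) \<theta>0 \<theta>1 = integral\<^sup>L M F"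
    by (simp add: error_prob_def F_def[abs_def] mult.assoc flip: integral_mult_right_zero)
  \<comment> \<open>The Bochner integral in \<open>error_prob\<close> equals the nonnegative
    integral if F is integrable and is 0 otherwise, so the inequality holds in both cases.\<close>
  also have "ennreal \<dots> \<le> (\<integral>\<^sup>+x. ennreal (F x) \<partial>M)"
    using F0 by (cases "integrable M F")
      (simp_all add: nn_integral_eq_integral not_integrable_integral_eq)
  also have "\<dots> \<le> (\<integral>\<^sup>+x. ennreal q * ennreal (p \<theta>0 x * \<bar>g x - \<theta>0\<bar> powr t)
      + ennreal (1 - q) * ennreal (p \<theta>1 x * \<bar>g x - \<theta>1\<bar> powr t) \<partial>M)"
  proof (rule nn_integral_mono)
    fix x
    have "F x \<le> q * p \<theta>0 x * \<bar>g x - \<theta>0\<bar> powr t + (1 - q) * p \<theta>1 x * \<bar>g x - \<theta>1\<bar> powr t"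
      unfolding F_def \<alpha>_def \<beta>_def mult.assoc
      using weighted_powr_loss_ge_min[of "q * p \<theta>0 x" "(1 - q) * p \<theta>1 x" r t \<theta>1 \<theta>0 "g x"]
        q r t n0[of x] n1[of x]
      by (simp add: mult.assoc)
    then show "ennreal (F x) \<le> ennreal q * ennreal (p \<theta>0 x * \<bar>g x - \<theta>0\<bar> powr t)
      + ennreal (1 - q) * ennreal (p \<theta>1 x * \<bar>g x - \<theta>1\<bar> powr t)"
      using q n0[of x] n1[of x]
      by (simp add: mult.assoc ennreal_leI flip: ennreal_mult ennreal_plus)
  qed
  also have "\<dots> = ennreal q * (\<integral>\<^sup>+x. ennreal (p \<theta>0 x * \<bar>g x - \<theta>0\<bar> powr t) \<partial>M)
      + ennreal (1 - q) * (\<integral>\<^sup>+x. ennreal (p \<theta>1 x * \<bar>g x - \<theta>1\<bar> powr t) \<partial>M)"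
    by (simp add: nn_integral_add nn_integral_cmult)
  finally show ?thesis
    using n0 n1 by (simp add: expected_loss_def ennreal_mult)
qed

theorem theorem3:
  fixes X :: "real set" and M :: "(real ^ 'n) measure"
    and \<Theta> :: "real set" and p :: "real \<Rightarrow> real ^ 'n \<Rightarrow> real" and t :: real
  assumes "reference_measure X M"
    and "\<And>\<theta>. \<theta> \<in> \<Theta> \<Longrightarrow> prob_density_on X M (p \<theta>)"
    and "t \<ge> 1"
  shows "minimax_risk X M p (\<lambda>\<epsilon>. \<bar>\<epsilon>\<bar> powr t) \<Theta> \<ge>
    (SUP (\<theta>0, \<theta>1, q, r) \<in> \<Theta> \<times> \<Theta> \<times> {0<..<1} \<times> {0<..<1}.
       ennreal (\<bar>\<theta>1 - \<theta>0\<bar> powr t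
         * ((1 - r) powr (t - 1) * q + r powr (t - 1) * (1 - q))
         * error_prob M p
             ((1 - r) powr (t - 1) * q / ((1 - r) powr (t - 1) * q + r powr (t - 1) * (1 - q)))
             \<theta>0 \<theta>1))"
  unfolding minimax_risk_def
proof (intro INF_greatest SUP_least, clarsimp, goal_cases)
  case (1 g \<theta>0 \<theta>1 q r)
  let ?R = "expected_loss M p (\<lambda>\<epsilon>. \<bar>\<epsilon>\<bar> powr t) g"
  have "ennreal q * ?R \<theta>0 + ennreal (1 - q) * ?R \<theta>1
      \<le> ennreal q * (SUP \<theta> \<in> \<Theta>. ?R \<theta>) + ennreal (1 - q) * (SUP \<theta> \<in> \<Theta>. ?R \<theta>)"
    using 1 by (intro add_mono mult_left_mono SUP_upper) auto
  \<comment> \<open>The weights q and 1 - q sum to 1, and distributivity in \<open>ennreal\<close>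
    covers an infinite supremum too.\<close>
  also have "\<dots> = (SUP \<theta> \<in> \<Theta>. ?R \<theta>)"
    using 1 by (simp flip: distrib_right ennreal_plus)
  finally show ?case
    using Bayes_risk_ge_error_prob[of X M p \<theta>0 \<theta>1 g \<Theta> q r t] assms 1
    by (meson order_trans)
qed

end
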